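(* Let $C_M>0$ be a fixed constant. For an integer $p\ge1$ and positive multipliers $\gamma=(\gamma_1,\dots,\gamma_p)\in(0,\infty)^p$ set $$S(\gamma):=\sum_{k=1}^p\gamma_k\,\frac{(C_M^2p^4)^{k-1}}{(k!)^2},\qquad B(\gamma):=\sum_{k=1}^p\gamma_k^{-1}.$$ Then $$S(\gamma)B(\gamma)\ \ge\ \left(\sum_{k=1}^p\frac{(C_Mp^2)^{k-1}}{k!}\right)^2\ \ge\ \frac{(C_Mp)^{2p}}{C_M^2p^4},$$ and the first inequality is an equality for $\gamma_k\propto k!\,(C_Mp^2)^{-(k-1)}$. Thus, no choice of positive profiles makes both $S(\gamma)$ and $B(\gamma)$ polynomially bounded in $p$.
   Context: In the paper $C_M$ is the absolute constant of the one-dimensional $L^2$ Markov inequality $\|r'\|_{L^2(0,H)}\le C_Mp^2H^{-1}\|r\|_{L^2(0,H)}$ for polynomials $r$ of degree at most $p$; only $C_M>0$ fixed is relevant here. *)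

theory Defs
  imports Complex_Main "HOL-Library.Landau_Symbols"
begin

text \<open>
  A tuple \<open>(\<gamma>\<^sub>1, \<dots>, \<gamma>\<^sub>p)\<close> is represented by a function on \<open>nat\<close> of which only
  the values on \<open>{1..p}\<close> matter.
\<close>

definition positive_multipliers :: "nat \<Rightarrow> (nat \<Rightarrow> real) \<Rightarrow> bool" where
  "positive_multipliers p \<gamma> \<longleftrightarrow> (\<forall>k\<in>{1..p}. 0 < \<gamma> k)"

definition S_sum :: "real \<Rightarrow> nat \<Rightarrow> (nat \<Rightarrow> real) \<Rightarrow> real" where
  "S_sum C p \<gamma> = (\<Sum>k=1..p. \<gamma> k * ((C ^ 2 * real p ^ 4) ^ (k - 1) / (fact k) ^ 2))"

definition B_sum :: "nat \<Rightarrow> (nat \<Rightarrow> real) \<Rightarrow> real" where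
  "B_sum p \<gamma> = (\<Sum>k=1..p. inverse (\<gamma> k))"

definition polynomially_bounded :: "(nat \<Rightarrow> real) \<Rightarrow> bool" where
  "polynomially_bounded f \<longleftrightarrow> (\<exists>d::nat. f \<in> O(\<lambda>p. real p ^ d))"

end

theory Submission
  imports Defs "HOL-Analysis.Convex" "HOL-Real_Asymp.Real_Asymp"
begin

text \<open>
  With \<open>x\<^sub>k = (C p\<^sup>2)\<^sup>k\<^sup>-\<^sup>1 / k!\<close> the first sum is \<open>S(\<gamma>) = \<Sum> \<gamma>\<^sub>k x\<^sub>k\<^sup>2\<close>, so writing
  \<open>x\<^sub>k\<close> as the product of \<open>\<surd>\<gamma>\<^sub>k x\<^sub>k\<close> and \<open>1 / \<surd>\<gamma>\<^sub>k\<close> turns the lower bound for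
  \<open>S(\<gamma>) B(\<gamma>)\<close> into the Cauchy--Schwarz inequality (\<open>weighted_Cauchy_Schwarz_sum\<close>). Equality
  occurs when the two vectors are proportional, that is, when \<open>\<gamma>\<^sub>k\<close> is proportional to \<open>1 / x\<^sub>k\<close>.

  The sum of the \<open>x\<^sub>k\<close> is at least its last term, and \<open>p! \<le> p\<^sup>p\<close> leaves for its square a lower
  bound that grows like \<open>(C p)\<^sup>2\<^sup>p\<close> up to a power of \<open>p\<close> (\<open>exponential_sum_lower_bound\<close>). This beats
  every power of \<open>p\<close>, whereas two polynomially bounded factors would have a polynomially
  bounded product.
\<close>

lemma weighted_Cauchy_Schwarz_sum:
  fixes w x :: "'a \<Rightarrow> real"
  assumes "\<And>i. i \<in> A \<Longrightarrow> 0 < w i"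
  shows "(\<Sum>i\<in>A. x i)\<^sup>2 \<le> (\<Sum>i\<in>A. w i * (x i)\<^sup>2) * (\<Sum>i\<in>A. inverse (w i))"
proof -
  have "(\<Sum>i\<in>A. (sqrt (w i) * x i) * (1 / sqrt (w i)))\<^sup>2
      \<le> (\<Sum>i\<in>A. (sqrt (w i) * x i)\<^sup>2) * (\<Sum>i\<in>A. (1 / sqrt (w i))\<^sup>2)"
    by (rule Cauchy_Schwarz_ineq_sum)
  also have "(\<Sum>i\<in>A. (sqrt (w i) * x i) * (1 / sqrt (w i))) = (\<Sum>i\<in>A. x i)"
    using assms by (intro sum.cong) (auto dest: assms)
  also have "(\<Sum>i\<in>A. (sqrt (w i) * x i)\<^sup>2) = (\<Sum>i\<in>A. w i * (x i)\<^sup>2)"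
    using assms by (intro sum.cong) (auto simp: power_mult_distrib less_imp_le)
  also have "(\<Sum>i\<in>A. (1 / sqrt (w i))\<^sup>2) = (\<Sum>i\<in>A. inverse (w i))"
    using assms by (intro sum.cong) (auto simp: power_divide less_imp_le inverse_eq_divide)
  finally show ?thesis .
qed

lemma S_sum_eq_weighted_squares:
  "S_sum C p \<gamma> = (\<Sum>k=1..p. \<gamma> k * ((C * real p ^ 2) ^ (k - 1) / fact k)\<^sup>2)"
proof -
  have "(C ^ 2 * real p ^ 4) ^ n = ((C * real p ^ 2) ^ n)\<^sup>2" for n
    by (simp add: power_mult_distrib mult.commute flip: power_mult)
  then show ?thesis
    by (simp add: S_sum_def power_divide)
qed

text \<open>
  Only the last term of the sum is kept: it has \<open>p\<^sup>2\<^sup>(\<^sup>p\<^sup>-\<^sup>1\<^sup>)\<close> in the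
  numerator, of which the factorial can take away at most \<open>p\<^sup>p\<close>, so a factor
  \<open>p\<^sup>p\<^sup>-\<^sup>2\<close> survives.
\<close>

lemma exponential_sum_lower_bound:
  fixes C :: real
  assumes "C > 0" and "p \<ge> 1"
  shows "(C * real p) ^ (2 * p) / (C ^ 2 * real p ^ 4)
      \<le> (\<Sum>k=1..p. (C * real p ^ 2) ^ (k - 1) / fact k)\<^sup>2"
proof -
  define a where "a = (C * real p ^ 2) ^ (p - 1) / fact p"
  have "(fact p :: real) \<le> real p ^ p"
    by (metis fact_le_power le_refl of_nat_fact of_nat_power of_nat_le_iff of_nat_id)
  then have "(C * real p ^ 2) ^ (p - 1) / real p ^ p \<le> a"
    unfolding a_def using assms by (intro divide_left_mono) auto
  moreover have "a \<le> (\<Sum>k=1..p. (C * real p ^ 2) ^ (k - 1) / fact k)"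
    unfolding a_def using assms
    by (intro member_le_sum[where f = "\<lambda>k. (C * real p ^ 2) ^ (k - 1) / fact k"]) auto
  ultimately have "((C * real p ^ 2) ^ (p - 1) / real p ^ p)\<^sup>2
      \<le> (\<Sum>k=1..p. (C * real p ^ 2) ^ (k - 1) / fact k)\<^sup>2"
    using assms by (intro power_mono) auto
  moreover have "((C * real p ^ 2) ^ (p - 1) / real p ^ p)\<^sup>2
      = (C * real p) ^ (2 * p) / (C ^ 2 * real p ^ 4)"
  proof -
    obtain q where q: "p = Suc q"
      using assms by (cases p) auto
    define x where "x = real p"
    have "x \<noteq> 0"
      using assms by (simp add: x_def)
    have "x ^ (2 * p) = x ^ (2 * q) * x\<^sup>2" "C ^ (2 * p) = C ^ (2 * q) * C\<^sup>2"
      by (simp_all add: q power2_eq_square)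
    moreover have "((C * x\<^sup>2) ^ q / x ^ p)\<^sup>2 = C ^ (2 * q) * (x ^ (2 * q))\<^sup>2 / x ^ (2 * p)"
      by (simp add: power_mult_distrib power_divide mult.commute flip: power_mult)
    ultimately have "((C * x\<^sup>2) ^ q / x ^ p)\<^sup>2 = (C * x) ^ (2 * p) / (C\<^sup>2 * x ^ 4)"
      using \<open>x \<noteq> 0\<close> \<open>C > 0\<close> by (simp add: power_mult_distrib power2_eq_square[of x]
        power2_eq_square[of "x ^ (2 * q)"] power4_eq_xxxx)
    then show ?thesis
      by (simp add: q x_def)
  qed
  ultimately show ?thesis
    by simp
qed

lemma power_smallo_superexponential:
  fixes C :: real
  assumes "C > 0"
  shows "(\<lambda>p. real p ^ d) \<in> o(\<lambda>p. (C * real p) ^ (2 * p) / (C ^ 2 * real p ^ 4))"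
  using assms by real_asymp

lemma S_B_lower_bound:
  assumes "positive_multipliers p \<gamma>"
  shows "(\<Sum>k=1..p. (C * real p ^ 2) ^ (k - 1) / fact k)\<^sup>2 \<le> S_sum C p \<gamma> * B_sum p \<gamma>"
  unfolding S_sum_eq_weighted_squares B_sum_def
  using assms by (intro weighted_Cauchy_Schwarz_sum) (auto simp: positive_multipliers_def)

text \<open>
  The prescribed profile is \<open>\<gamma>\<^sub>k = c / x\<^sub>k\<close>, so that \<open>S(\<gamma>) = c \<Sum> x\<^sub>k\<close> and
  \<open>B(\<gamma>) = (\<Sum> x\<^sub>k) / c\<close>.
\<close>

lemma S_B_equality:
  fixes C c :: real
  assumes "C > 0" and "p \<ge> 1" and "c > 0"
    and \<gamma>: "\<forall>k\<in>{1..p}. \<gamma> k = c * (fact k / (C * real p ^ 2) ^ (k - 1))"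
  shows "S_sum C p \<gamma> * B_sum p \<gamma> = (\<Sum>k=1..p. (C * real p ^ 2) ^ (k - 1) / fact k)\<^sup>2"
proof -
  define x where "x k = (C * real p ^ 2) ^ (k - 1) / fact k" for k
  have x: "x k > 0" for k
    using assms by (simp add: x_def)
  have \<gamma>': "\<gamma> k = c / x k" if "k \<in> {1..p}" for k
    using \<gamma> that by (simp add: x_def)
  have "S_sum C p \<gamma> = (\<Sum>k=1..p. c * x k)"
    unfolding S_sum_eq_weighted_squares x_def[symmetric]
    using x by (intro sum.cong) (auto simp: \<gamma>' power2_eq_square less_imp_neq[THEN not_sym])
  moreover have "B_sum p \<gamma> = (\<Sum>k=1..p. x k / c)"
    unfolding B_sum_def by (intro sum.cong) (auto simp: \<gamma>')
  ultimately show ?thesis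
    using \<open>c > 0\<close> unfolding x_def[symmetric]
    by (simp add: power2_eq_square flip: sum_distrib_left sum_divide_distrib)
qed

lemma not_both_polynomially_bounded:
  fixes C :: real
  assumes "C > 0"
    and pos: "\<forall>p\<ge>1. positive_multipliers p (\<gamma> p)"
    and S: "polynomially_bounded (\<lambda>p. S_sum C p (\<gamma> p))"
    and B: "polynomially_bounded (\<lambda>p. B_sum p (\<gamma> p))"
  shows False
proof -
  let ?L = "\<lambda>p. (C * real p) ^ (2 * p) / (C ^ 2 * real p ^ 4)"
  obtain d e where "(\<lambda>p. S_sum C p (\<gamma> p)) \<in> O(\<lambda>p. real p ^ d)"
    and "(\<lambda>p. B_sum p (\<gamma> p)) \<in> O(\<lambda>p. real p ^ e)"
    using S B unfolding polynomially_bounded_def by blast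
  then have upper: "(\<lambda>p. S_sum C p (\<gamma> p) * B_sum p (\<gamma> p)) \<in> O(\<lambda>p. real p ^ (d + e))"
    unfolding power_add by (rule landau_o.big.mult)
  have "?L p \<le> S_sum C p (\<gamma> p) * B_sum p (\<gamma> p)" if "p \<ge> 1" for p
    using exponential_sum_lower_bound[OF \<open>C > 0\<close> that] S_B_lower_bound[of p "\<gamma> p" C] pos that
    by (meson order_trans)
  moreover have "0 \<le> ?L p" for p
    using \<open>C > 0\<close> by simp
  ultimately have "?L \<in> O(\<lambda>p. S_sum C p (\<gamma> p) * B_sum p (\<gamma> p))"
    by (intro bigoI[of _ 1] eventually_mono[OF eventually_ge_at_top[of 1]]) force
  then have "?L \<in> O(\<lambda>p. real p ^ (d + e))"
    using upper by (rule landau_o.big_trans)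
  \<comment> \<open>A sequence that is negligible against itself is eventually zero.\<close>
  then have "?L \<in> o(?L)"
    using power_smallo_superexponential[OF \<open>C > 0\<close>] by (rule landau_o.big_small_trans)
  then have "eventually (\<lambda>p. ?L p = 0) sequentially"
    by (simp add: landau_o.small_refl_iff)
  moreover have "eventually (\<lambda>p. ?L p \<noteq> 0) sequentially"
    using eventually_gt_at_top[of 0] by eventually_elim (use \<open>C > 0\<close> in simp)
  ultimately have "eventually (\<lambda>p::nat. False) sequentially"
    by eventually_elim simp
  then show False
    by simp
qed

theorem mainTheorem10:
  fixes C_M :: real
  assumes "C_M > 0"
  shows
    "(\<forall>p\<ge>1. \<forall>\<gamma>. positive_multipliers p \<gamma> \<longrightarrow>
        S_sum C_M p \<gamma> * B_sum p \<gamma>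
          \<ge> (\<Sum>k=1..p. (C_M * real p ^ 2) ^ (k - 1) / fact k) ^ 2 \<and>
        (\<Sum>k=1..p. (C_M * real p ^ 2) ^ (k - 1) / fact k) ^ 2
          \<ge> (C_M * real p) ^ (2 * p) / (C_M ^ 2 * real p ^ 4)) \<and>
     (\<forall>p\<ge>1. \<forall>\<gamma>. \<forall>c>0.
        (\<forall>k\<in>{1..p}. \<gamma> k = c * (fact k / (C_M * real p ^ 2) ^ (k - 1))) \<longrightarrow>
        S_sum C_M p \<gamma> * B_sum p \<gamma>
          = (\<Sum>k=1..p. (C_M * real p ^ 2) ^ (k - 1) / fact k) ^ 2) \<and>
     \<not> (\<exists>\<gamma>. (\<forall>p\<ge>1. positive_multipliers p (\<gamma> p)) \<and>
          polynomially_bounded (\<lambda>p. S_sum C_M p (\<gamma> p)) \<and>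
          polynomially_bounded (\<lambda>p. B_sum p (\<gamma> p)))"
proof (intro conjI allI impI)
  fix p :: nat and \<gamma> :: "nat \<Rightarrow> real"
  assume "p \<ge> 1" and "positive_multipliers p \<gamma>"
  then show "S_sum C_M p \<gamma> * B_sum p \<gamma>
      \<ge> (\<Sum>k=1..p. (C_M * real p ^ 2) ^ (k - 1) / fact k) ^ 2"
    by (intro S_B_lower_bound)
  show "(\<Sum>k=1..p. (C_M * real p ^ 2) ^ (k - 1) / fact k) ^ 2
      \<ge> (C_M * real p) ^ (2 * p) / (C_M ^ 2 * real p ^ 4)"
    using assms \<open>p \<ge> 1\<close> by (rule exponential_sum_lower_bound)
next
  fix p :: nat and \<gamma> :: "nat \<Rightarrow> real" and c :: real
  assume "p \<ge> 1" and "0 < c"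
    and "\<forall>k\<in>{1..p}. \<gamma> k = c * (fact k / (C_M * real p ^ 2) ^ (k - 1))"
  with assms show "S_sum C_M p \<gamma> * B_sum p \<gamma>
      = (\<Sum>k=1..p. (C_M * real p ^ 2) ^ (k - 1) / fact k) ^ 2"
    by (intro S_B_equality)
next
  show "\<not> (\<exists>\<gamma>. (\<forall>p\<ge>1. positive_multipliers p (\<gamma> p)) \<and>
      polynomially_bounded (\<lambda>p. S_sum C_M p (\<gamma> p)) \<and>
      polynomially_bounded (\<lambda>p. B_sum p (\<gamma> p)))"
    using not_both_polynomially_bounded[OF assms] by blast
qed

end
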